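(* The asymptotic relation (Cramér–Shanks conjecture) $$\max_{j:\ p_j\le x}(p_{j+1}-p_j)\sim(\log x)^2\qquad\text{as } x\to\infty$$ holds if and only if the maximal gap $G_n:=\max\{d_1,\ldots,d_n\}$ satisfies $$G_n\sim(\log n)^2\qquad\text{as } n\to\infty .$$
   Context: $p_n$ is the $n$th prime, with $p_1=2$, and $d_n:=p_{n+1}-p_n$ for $n\ge1$. The variable $x$ is real. The notation $f\sim g$ means that $f/g\to1$ as the argument tends to infinity. *)

theory Defs
  imports
    Complex_Main
    "HOL-Computational_Algebra.Primes"
    "HOL-Library.Infinite_Set"
    "HOL-Library.Landau_Symbols"
begin

text \<open>Indexing is 1-based, so \<open>nth_prime 1 = 2\<close>; the value at index 0 carries no meaning.\<close>

definition nth_prime :: "nat \<Rightarrow> nat" where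
  "nth_prime n = enumerate {p. prime p} (n - 1)"

text \<open>The subtraction below never truncates for \<open>n \<ge> 1\<close>, as the primes are enumerated
  increasingly.\<close>

definition prime_gap :: "nat \<Rightarrow> nat" where
  "prime_gap n = nth_prime (n + 1) - nth_prime n"

definition max_gap :: "nat \<Rightarrow> nat" where
  "max_gap n = Max (prime_gap ` {1..n})"

text \<open>The index set is finite, and nonempty exactly when \<open>x \<ge> 2\<close>; only large \<open>x\<close> matter.\<close>

definition max_gap_upto :: "real \<Rightarrow> nat" where
  "max_gap_upto x = Max {prime_gap j | j. j \<ge> 1 \<and> real (nth_prime j) \<le> x}"

definition cramer_shanks_conjecture :: bool where
  "cramer_shanks_conjecture \<longleftrightarrow>
     (\<lambda>x::real. real (max_gap_upto x)) \<sim>[at_top] (\<lambda>x. (ln x)\<^sup>2)"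

end

theory Submission
  imports Defs "HOL-Real_Asymp.Real_Asymp"
begin

text \<open>
  Let \<open>G\<^sub>n\<close> be the maximum of the first \<open>n\<close> prime gaps. For \<open>p\<^sub>n \<le> x < p\<^sub>n\<^sub>+\<^sub>1\<close> the
  maximal gap up to \<open>x\<close> is \<open>G\<^sub>n\<close>, so the two relations differ only in that one compares \<open>G\<^sub>n\<close>
  with \<open>(ln x)\<^sup>2\<close> and the other with \<open>(ln n)\<^sup>2\<close>. They are equivalent once \<open>ln p\<^sub>n \<sim> ln n\<close> is
  known.

  That relation follows from Chebyshev's estimates, but these are not needed here, because
  either of the two relations already implies \<open>G\<^sub>n \<le> 2 (ln p\<^sub>n)\<^sup>2\<close> for large \<open>n\<close>.
  Telescoping then gives \<open>p\<^sub>n \<le> p\<^sub>n\<^sub>+\<^sub>1 \<le> 2 + n G\<^sub>n \<le> 4 n (ln p\<^sub>n)\<^sup>2\<close>, hence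
  \<open>ln p\<^sub>n - ln 4 - 2 ln (ln p\<^sub>n) \<le> ln n \<le> ln p\<^sub>n\<close>, and both bounds are \<open>\<sim> ln p\<^sub>n\<close>
  (lemma \<open>ln_nth_prime_asymp\<close>). The passage from \<open>n\<close> to real \<open>x\<close> sandwiches \<open>ln x\<close> between
  \<open>ln p\<^sub>n\<close> and \<open>ln p\<^sub>n\<^sub>+\<^sub>1\<close>, where \<open>n\<close> is the number of primes up to \<open>x\<close>.
\<close>

lemma prime_nth_prime: "prime (nth_prime n)"
  using enumerate_in_set[OF primes_infinite, of "n - 1"] by (simp add: nth_prime_def)

lemma nth_prime_1: "nth_prime 1 = 2"
proof -
  have "(LEAST p::nat. prime p) = 2"
    by (rule Least_equality) (auto simp: prime_ge_2_nat)
  thus ?thesis by (simp add: nth_prime_def enumerate_0)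
qed

lemma nth_prime_less: "1 \<le> i \<Longrightarrow> i < j \<Longrightarrow> nth_prime i < nth_prime j"
  unfolding nth_prime_def by (rule enumerate_mono[OF _ primes_infinite]) simp

lemma nth_prime_le: "1 \<le> i \<Longrightarrow> i \<le> j \<Longrightarrow> nth_prime i \<le> nth_prime j"
  using nth_prime_less[of i j] by (cases "i = j") auto

lemma le_nth_prime: "n \<le> nth_prime n"
proof (induction n)
  case (Suc n)
  show ?case
  proof (cases "n = 0")
    case True
    thus ?thesis using nth_prime_1 by simp
  next
    case False
    thus ?thesis using Suc nth_prime_less[of n "Suc n"] by simp
  qed
qed simp

lemma filterlim_nth_prime: "filterlim (\<lambda>n. real (nth_prime n)) at_top at_top"
proof (rule filterlim_at_top_mono[OF filterlim_real_sequentially])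
  show "eventually (\<lambda>n. real n \<le> real (nth_prime n)) at_top"
    using le_nth_prime by simp
qed

text \<open>
  For \<open>n = 0\<close> the maximum is over the empty set, but its unspecified value is multiplied by \<open>0\<close>.
\<close>

lemma nth_prime_Suc_le: "nth_prime (Suc n) \<le> 2 + n * max_gap n"
proof -
  have telescope: "nth_prime (Suc n) = 2 + (\<Sum>i=1..n. prime_gap i)"
  proof (induction n)
    case 0
    thus ?case using nth_prime_1 by simp
  next
    case (Suc n)
    have "nth_prime (Suc (Suc n)) = nth_prime (Suc n) + prime_gap (Suc n)"
      using nth_prime_less[of "Suc n" "Suc (Suc n)"] by (simp add: prime_gap_def)
    thus ?case using Suc by simp
  qed
  have "(\<Sum>i=1..n. prime_gap i) \<le> of_nat (card {1..n}) * max_gap n"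
    by (rule sum_bounded_above) (auto simp: max_gap_def intro!: Max_ge)
  thus ?thesis using telescope by simp
qed

text \<open>
  The constant \<open>2\<close> is immaterial: any bound on the gaps that is subpolynomial in \<open>p\<^sub>n\<close> would do.
\<close>

lemma ln_nth_prime_asymp:
  assumes "eventually (\<lambda>n. real (max_gap n) \<le> 2 * (ln (real (nth_prime n)))\<^sup>2) at_top"
  shows "(\<lambda>n. ln (real (nth_prime n))) \<sim>[at_top] (\<lambda>n. ln (real n))"
proof -
  define L where "L = (\<lambda>n. ln (real (nth_prime n)))"
  have lim: "filterlim L at_top at_top"
    unfolding L_def by (rule filterlim_compose[OF ln_at_top filterlim_nth_prime])
  have lower: "eventually (\<lambda>n. L n - ln 4 - 2 * ln (L n) \<le> ln (real n)) at_top"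
    using assms filterlim_at_top[THEN iffD1, OF lim, rule_format, of 1] eventually_gt_at_top[of 0]
  proof eventually_elim
    case (elim n)
    have "real (nth_prime n) \<le> real (nth_prime (Suc n))"
      using nth_prime_le[of n "Suc n"] elim by simp
    also have "\<dots> \<le> 2 + real n * real (max_gap n)"
      using nth_prime_Suc_le[of n] by (metis of_nat_add of_nat_le_iff of_nat_mult of_nat_numeral)
    also have "\<dots> \<le> 2 + real n * (2 * (L n)\<^sup>2)"
      using elim by (intro add_left_mono mult_left_mono) (auto simp: L_def)
    also have "\<dots> \<le> 4 * real n * (L n)\<^sup>2"
    proof -
      have "1 * 1 \<le> real n * (L n)\<^sup>2"
        using elim by (intro mult_mono) auto
      thus ?thesis by simp
    qed
    finally have "L n \<le> ln (4 * real n * (L n)\<^sup>2)"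
      unfolding L_def using prime_gt_0_nat[OF prime_nth_prime[of n]]
      by (subst ln_le_cancel_iff) auto
    also have "\<dots> = ln 4 + ln (real n) + 2 * ln (L n)"
      using elim by (simp add: ln_mult ln_realpow)
    finally show ?case by simp
  qed
  have upper: "eventually (\<lambda>n. ln (real n) \<le> L n) at_top"
    using eventually_gt_at_top[of 0]
    by eventually_elim (use le_nth_prime prime_gt_0_nat[OF prime_nth_prime] in
        \<open>auto simp: L_def intro!: ln_mono\<close>)
  have "(\<lambda>t::real. t - ln 4 - 2 * ln t) \<sim>[at_top] (\<lambda>t. t)"
    by real_asymp
  from asymp_equiv_compose'[OF this lim]
  have eq: "(\<lambda>n. L n - ln 4 - 2 * ln (L n)) \<sim>[at_top] L" by simp
  have "(\<lambda>n. ln (real n)) \<sim>[at_top] L"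
    by (rule asymp_equiv_sandwich_real[OF eq asymp_equiv_refl])
       (use lower upper in eventually_elim, simp)
  thus ?thesis unfolding L_def by (rule asymp_equiv_symI)
qed

text \<open>
  The prime counting function, as the least \<open>n\<close> for which the prime number \<open>n + 1\<close> exceeds \<open>x\<close>.
\<close>

definition prime_count :: "real \<Rightarrow> nat" where
  "prime_count x = (LEAST n. x < real (nth_prime (Suc n)))"

lemma less_nth_prime_prime_count: "x < real (nth_prime (Suc (prime_count x)))"
proof -
  obtain n where "x < real n" using reals_Archimedean2 by blast
  also have "real n \<le> real (nth_prime (Suc n))"
    using le_nth_prime[of "Suc n"] by simp
  finally show ?thesis unfolding prime_count_def by (rule LeastI)
qed

lemma nth_prime_le_iff:
  assumes "1 \<le> j"
  shows "real (nth_prime j) \<le> x \<longleftrightarrow> j \<le> prime_count x"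
proof
  assume le: "real (nth_prime j) \<le> x"
  show "j \<le> prime_count x"
  proof (rule ccontr)
    assume "\<not> j \<le> prime_count x"
    hence "nth_prime (Suc (prime_count x)) \<le> nth_prime j"
      by (intro nth_prime_le) auto
    with le less_nth_prime_prime_count[of x] show False by linarith
  qed
next
  assume "j \<le> prime_count x"
  hence "j - 1 < (LEAST n. x < real (nth_prime (Suc n)))"
    using assms by (simp add: prime_count_def)
  from not_less_Least[OF this] show "real (nth_prime j) \<le> x"
    using assms by simp
qed

lemma filterlim_prime_count: "filterlim prime_count at_top at_top"
  unfolding filterlim_at_top
proof
  fix n :: nat
  show "eventually (\<lambda>x. n \<le> prime_count x) at_top"
    using eventually_ge_at_top[of "real (nth_prime (Suc n))"]
    by eventually_elim (use nth_prime_le_iff[of "Suc n"] in force)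
qed

text \<open>
  No condition \<open>x \<ge> 2\<close> is needed: for smaller \<open>x\<close> both sides are the maximum of the empty set.
\<close>

lemma max_gap_upto_eq: "max_gap_upto x = max_gap (prime_count x)"
proof -
  have "{prime_gap j | j. j \<ge> 1 \<and> real (nth_prime j) \<le> x} = prime_gap ` {1..prime_count x}"
    using nth_prime_le_iff[of _ x] by auto
  thus ?thesis by (simp add: max_gap_upto_def max_gap_def)
qed

lemma max_gap_upto_nth_prime:
  assumes "1 \<le> n"
  shows "max_gap_upto (real (nth_prime n)) = max_gap n"
proof -
  have "n \<le> prime_count (real (nth_prime n))"
    using nth_prime_le_iff[OF assms] by blast
  moreover have "\<not> Suc n \<le> prime_count (real (nth_prime n))"
    using nth_prime_le_iff[of "Suc n" "real (nth_prime n)"] nth_prime_less[of n "Suc n"] assms by simp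
  ultimately show ?thesis by (simp add: max_gap_upto_eq le_antisym not_less_eq_eq)
qed

lemma ln_prime_count_asymp:
  assumes "(\<lambda>n. ln (real (nth_prime n))) \<sim>[at_top] (\<lambda>n. ln (real n))"
  shows "(\<lambda>x. ln (real (prime_count x))) \<sim>[at_top] ln"
proof -
  have lower: "(\<lambda>x. ln (real (nth_prime (prime_count x)))) \<sim>[at_top]
      (\<lambda>x. ln (real (prime_count x)))"
    by (rule asymp_equiv_compose'[OF assms filterlim_prime_count])
  have "(\<lambda>n. ln (real (nth_prime (Suc n)))) \<sim>[at_top] (\<lambda>n. ln (real (Suc n)))"
    by (rule asymp_equiv_compose'[OF assms filterlim_Suc])
  also have "(\<lambda>n. ln (real (Suc n))) \<sim>[at_top] (\<lambda>n. ln (real n))"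
    by real_asymp
  finally have upper: "(\<lambda>x. ln (real (nth_prime (Suc (prime_count x))))) \<sim>[at_top]
      (\<lambda>x. ln (real (prime_count x)))"
    by (rule asymp_equiv_compose'[OF _ filterlim_prime_count])
  have "eventually (\<lambda>x. ln x \<in> {ln (real (nth_prime (prime_count x)))..
      ln (real (nth_prime (Suc (prime_count x))))}) at_top"
    using eventually_ge_at_top[of 2]
  proof eventually_elim
    case (elim x)
    hence "1 \<le> prime_count x"
      using nth_prime_le_iff[of 1 x] nth_prime_1 by simp
    hence "real (nth_prime (prime_count x)) \<le> x"
      using nth_prime_le_iff by blast
    thus ?case
      using elim less_nth_prime_prime_count[of x] prime_gt_0_nat[OF prime_nth_prime]
      by (auto intro!: ln_mono less_imp_le)
  qed
  from asymp_equiv_sandwich_real[OF lower upper this] show ?thesis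
    by (rule asymp_equiv_symI)
qed

theorem theorem6:
  shows "cramer_shanks_conjecture \<longleftrightarrow>
    (\<lambda>n::nat. real (max_gap n)) \<sim>[at_top] (\<lambda>n. (ln (real n))\<^sup>2)"
proof
  assume "cramer_shanks_conjecture"
  hence "(\<lambda>x. real (max_gap_upto x)) \<sim>[at_top] (\<lambda>x. (ln x)\<^sup>2)"
    by (simp add: cramer_shanks_conjecture_def)
  from asymp_equiv_compose'[OF this filterlim_nth_prime]
  have "(\<lambda>n. real (max_gap_upto (real (nth_prime n)))) \<sim>[at_top]
      (\<lambda>n. (ln (real (nth_prime n)))\<^sup>2)" .
  moreover have "eventually (\<lambda>n. real (max_gap_upto (real (nth_prime n))) = real (max_gap n)) at_top"
    using eventually_ge_at_top[of 1] by eventually_elim (simp add: max_gap_upto_nth_prime)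
  ultimately have gap: "(\<lambda>n. real (max_gap n)) \<sim>[at_top] (\<lambda>n. (ln (real (nth_prime n)))\<^sup>2)"
    by (subst (asm) asymp_equiv_cong[OF _ always_eventually]) auto
  have "(\<lambda>n. ln (real (nth_prime n))) \<sim>[at_top] (\<lambda>n. ln (real n))"
    using asymp_equiv_imp_eventually_le[OF gap, of 2] by (intro ln_nth_prime_asymp) simp
  from asymp_equiv_trans[OF gap asymp_equiv_power[OF this]]
  show "(\<lambda>n. real (max_gap n)) \<sim>[at_top] (\<lambda>n. (ln (real n))\<^sup>2)" .
next
  assume gap: "(\<lambda>n. real (max_gap n)) \<sim>[at_top] (\<lambda>n. (ln (real n))\<^sup>2)"
  have "eventually (\<lambda>n. real (max_gap n) \<le> 2 * (ln (real n))\<^sup>2) at_top"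
    using asymp_equiv_imp_eventually_le[OF gap, of 2] by simp
  hence "eventually (\<lambda>n. real (max_gap n) \<le> 2 * (ln (real (nth_prime n)))\<^sup>2) at_top"
    using eventually_ge_at_top[of 1]
  proof eventually_elim
    case (elim n)
    have "ln (real n) \<le> ln (real (nth_prime n))"
      using elim le_nth_prime[of n] by (intro ln_mono) auto
    hence "(ln (real n))\<^sup>2 \<le> (ln (real (nth_prime n)))\<^sup>2"
      using elim by (intro power_mono) auto
    thus ?case using elim by linarith
  qed
  hence "(\<lambda>x. ln (real (prime_count x))) \<sim>[at_top] ln"
    by (intro ln_prime_count_asymp ln_nth_prime_asymp)
  from asymp_equiv_trans[OF asymp_equiv_compose'[OF gap filterlim_prime_count]
      asymp_equiv_power[OF this]]
  show "cramer_shanks_conjecture"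
    by (simp add: cramer_shanks_conjecture_def max_gap_upto_eq)
qed

end
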